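(* Let $G$ be a group, let $I$ be a non-empty set, and let $S=M^{0}(G,I)$ be the Brandt semigroup over $G$ with index set $I$. Then the following are equivalent: (i) $\ell^{1}(S)$ has an ultra central approximate identity; (ii) $I$ is finite.
   Context: The Brandt semigroup over $G$ with index set $I$ is $M^{0}(G,I)=\{(g)_{i,j}: g\in G,\ i,j\in I\}\cup\{0\}$, where $(g)_{i,j}$ denotes the $I\times I$ matrix with $g$ in the $(i,j)$-position and zero elsewhere, with multiplication $(g)_{i,j}\ast(h)_{k,l}=(gh)_{i,l}$ if $j=k$ and $(g)_{i,j}\ast(h)_{k,l}=0$ if $j\neq k$, and with $0$ acting as a zero element. $\ell^{1}(S)$ is the semigroup algebra of $S$: the Banach space of absolutely summable functions $S\to\mathbb{C}$ with the convolution product determined by $\delta_{s}\ast\delta_{t}=\delta_{st}$. For a Banach algebra $A$ and a Banach $A$-bimodule $X$, the dual $X^{*}$ is a Banach $A$-bimodule via $(a\cdot f)(x)=f(x\cdot a)$ and $(f\cdot a)(x)=f(a\cdot x)$ for $a\in A$, $x\in X$, $f\in X^{*}$. In particular $A^{**}$ is a Banach $A$-bimodule, and $A$ is regarded as a subspace of $A^{**}$ via the canonical embedding. A Banach algebra $A$ has an ultra central approximate identity if there exists a net $(e_{\alpha})$ in $A^{**}$ such that $ae_{\alpha}=e_{\alpha}a$ for every $\alpha$ and $e_{\alpha}a\rightarrow a$ (in the norm of $A^{**}$), for every $a\in A$. The net is not required to be bounded. *)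

theory Defs
  imports "HOL-Algebra.Group" "HOL-Analysis.Infinite_Sum"
begin

text \<open>\<open>Entry g i j\<close> is the matrix with \<open>g\<close> in position \<open>(i, j)\<close>
  and zeros elsewhere, and \<open>Zero\<close> is the zero matrix.\<close>

datatype ('g, 'i) brandt = Zero | Entry 'g 'i 'i

definition brandt_carrier :: "('g, 'b) monoid_scheme \<Rightarrow> 'i set \<Rightarrow> ('g, 'i) brandt set" where
  "brandt_carrier G I = {Entry g i j | g i j. g \<in> carrier G \<and> i \<in> I \<and> j \<in> I} \<union> {Zero}"

fun brandt_mult ::
  "('g, 'b) monoid_scheme \<Rightarrow> ('g, 'i) brandt \<Rightarrow> ('g, 'i) brandt \<Rightarrow> ('g, 'i) brandt" where
  "brandt_mult G (Entry g i j) (Entry h k l) =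
     (if j = k then Entry (g \<otimes>\<^bsub>G\<^esub> h) i l else Zero)"
| "brandt_mult G Zero t = Zero"
| "brandt_mult G s Zero = Zero"

lemma brandt_mult_closed:
  assumes "group G" "s \<in> brandt_carrier G I" "t \<in> brandt_carrier G I"
  shows "brandt_mult G s t \<in> brandt_carrier G I"
proof -
  interpret group G by fact
  show ?thesis using assms(2,3) by (cases s; cases t) (auto simp: brandt_carrier_def)
qed

lemma brandt_mult_assoc:
  assumes "group G" "s \<in> brandt_carrier G I" "t \<in> brandt_carrier G I" "u \<in> brandt_carrier G I"
  shows "brandt_mult G (brandt_mult G s t) u = brandt_mult G s (brandt_mult G t u)"
proof -
  interpret group G by fact
  show ?thesis using assms(2-)
    by (cases s; cases t; cases u) (auto simp: brandt_carrier_def m_assoc)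
qed

text \<open>
  The records carry the operations only; all definitions below are relative to the carrier.
\<close>

record 'x cnspace = "'x partial_object" +
  vadd :: "'x \<Rightarrow> 'x \<Rightarrow> 'x"
  vscale :: "complex \<Rightarrow> 'x \<Rightarrow> 'x"
  vnorm :: "'x \<Rightarrow> real"

record 'a cnalgebra = "'a cnspace" +
  amult :: "'a \<Rightarrow> 'a \<Rightarrow> 'a"

record ('a, 'x) bimod = "'x cnspace" +
  lact :: "'a \<Rightarrow> 'x \<Rightarrow> 'x"
  ract :: "'x \<Rightarrow> 'a \<Rightarrow> 'x"

definition vdiff :: "('x, 'm) cnspace_scheme \<Rightarrow> 'x \<Rightarrow> 'x \<Rightarrow> 'x" where
  "vdiff X x y = vadd X x (vscale X (-1) y)"

text \<open>
  Bounded complex-linear functionals. They are normalised to be \<open>0\<close> off the carrier,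
  so that equality of functionals is equality of HOL functions.
\<close>

definition dual_carrier :: "('x, 'm) cnspace_scheme \<Rightarrow> ('x \<Rightarrow> complex) set" where
  "dual_carrier X = {f.
     (\<forall>x. x \<notin> carrier X \<longrightarrow> f x = 0) \<and>
     (\<forall>x\<in>carrier X. \<forall>y\<in>carrier X. f (vadd X x y) = f x + f y) \<and>
     (\<forall>c. \<forall>x\<in>carrier X. f (vscale X c x) = c * f x) \<and>
     (\<exists>K. \<forall>x\<in>carrier X. cmod (f x) \<le> K * vnorm X x)}"

definition dual_norm :: "('x, 'm) cnspace_scheme \<Rightarrow> ('x \<Rightarrow> complex) \<Rightarrow> real" where
  "dual_norm X f = (SUP x\<in>{x\<in>carrier X. vnorm X x \<le> 1}. cmod (f x))"

definition dual_bimod :: "('a, 'x) bimod \<Rightarrow> ('a, 'x \<Rightarrow> complex) bimod" where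
  "dual_bimod X = \<lparr>
     carrier = dual_carrier X,
     vadd = (\<lambda>f g x. f x + g x),
     vscale = (\<lambda>c f x. c * f x),
     vnorm = dual_norm X,
     lact = (\<lambda>a f x. if x \<in> carrier X then f (ract X x a) else 0),
     ract = (\<lambda>f a x. if x \<in> carrier X then f (lact X a x) else 0)\<rparr>"

definition self_bimod :: "'a cnalgebra \<Rightarrow> ('a, 'a) bimod" where
  "self_bimod A = \<lparr>
     carrier = carrier A, vadd = vadd A, vscale = vscale A, vnorm = vnorm A,
     lact = amult A, ract = amult A\<rparr>"

definition bidual :: "'a cnalgebra \<Rightarrow> ('a, ('a \<Rightarrow> complex) \<Rightarrow> complex) bimod" where
  "bidual A = dual_bimod (dual_bimod (self_bimod A))"

definition bidual_embed :: "'a cnalgebra \<Rightarrow> 'a \<Rightarrow> ('a \<Rightarrow> complex) \<Rightarrow> complex" where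
  "bidual_embed A a = (\<lambda>f. if f \<in> carrier (dual_bimod (self_bimod A)) then f a else 0)"

definition directed_on :: "'k set \<Rightarrow> ('k \<times> 'k) set \<Rightarrow> bool" where
  "directed_on D r \<longleftrightarrow> D \<noteq> {} \<and>
     (\<forall>\<alpha>\<in>D. (\<alpha>, \<alpha>) \<in> r) \<and>
     (\<forall>\<alpha>\<in>D. \<forall>\<beta>\<in>D. \<forall>\<gamma>\<in>D. (\<alpha>, \<beta>) \<in> r \<longrightarrow> (\<beta>, \<gamma>) \<in> r \<longrightarrow> (\<alpha>, \<gamma>) \<in> r) \<and>
     (\<forall>\<alpha>\<in>D. \<forall>\<beta>\<in>D. \<exists>\<gamma>\<in>D. (\<alpha>, \<gamma>) \<in> r \<and> (\<beta>, \<gamma>) \<in> r)"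

definition ultra_central_approx_identity ::
  "'a cnalgebra \<Rightarrow> 'k set \<Rightarrow> ('k \<times> 'k) set \<Rightarrow> ('k \<Rightarrow> ('a \<Rightarrow> complex) \<Rightarrow> complex) \<Rightarrow> bool" where
  "ultra_central_approx_identity A D r e \<longleftrightarrow>
     directed_on D r \<and>
     (\<forall>\<alpha>\<in>D. e \<alpha> \<in> carrier (bidual A)) \<and>
     (\<forall>a\<in>carrier A. \<forall>\<alpha>\<in>D. lact (bidual A) a (e \<alpha>) = ract (bidual A) (e \<alpha>) a) \<and>
     (\<forall>a\<in>carrier A. \<forall>\<epsilon>>0. \<exists>\<beta>\<in>D. \<forall>\<alpha>\<in>D. (\<beta>, \<alpha>) \<in> r \<longrightarrow>
        vnorm (bidual A) (vdiff (bidual A) (ract (bidual A) (e \<alpha>) a) (bidual_embed A a)) < \<epsilon>)"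

text \<open>
  HOL cannot quantify existentially over the type of the index set, so an index type has to be
  fixed. The one chosen, pairs of a point and a subset of the bidual, is no restriction, by
  \<open>has_ultra_central_approx_identityI\<close>.
\<close>

definition has_ultra_central_approx_identity :: "'a cnalgebra \<Rightarrow> bool" where
  "has_ultra_central_approx_identity A \<longleftrightarrow>
     (\<exists>D r (e :: (('a \<Rightarrow> complex) \<Rightarrow> complex) \<times> (('a \<Rightarrow> complex) \<Rightarrow> complex) set
                  \<Rightarrow> ('a \<Rightarrow> complex) \<Rightarrow> complex).
        ultra_central_approx_identity A D r e)"

lemma has_ultra_central_approx_identityI:
  fixes D :: "'k set"
  assumes "ultra_central_approx_identity A D r e"
  shows "has_ultra_central_approx_identity A"
proof -
  define T where "T \<beta> = e ` {\<alpha>\<in>D. (\<beta>, \<alpha>) \<in> r}" for \<beta>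
  define D' where "D' = {(m, E). m \<in> E \<and> E \<in> T ` D}"
  define r' :: "((('a \<Rightarrow> complex) \<Rightarrow> complex) \<times> (('a \<Rightarrow> complex) \<Rightarrow> complex) set) rel"
    where "r' = {(x, y). snd y \<subseteq> snd x}"
  have dir: "directed_on D r" using assms by (simp add: ultra_central_approx_identity_def)
  have refl: "(\<alpha>, \<alpha>) \<in> r" if "\<alpha> \<in> D" for \<alpha> using dir that by (simp add: directed_on_def)
  have tr: "(\<alpha>, \<gamma>) \<in> r" if "\<alpha> \<in> D" "\<beta> \<in> D" "\<gamma> \<in> D" "(\<alpha>, \<beta>) \<in> r" "(\<beta>, \<gamma>) \<in> r" for \<alpha> \<beta> \<gamma>
    using dir that unfolding directed_on_def by blast
  have in_D': "(e \<beta>, T \<beta>) \<in> D'" if "\<beta> \<in> D" for \<beta>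
    using that refl by (auto simp: D'_def T_def)
  have T_mono: "T \<gamma> \<subseteq> T \<beta>" if "\<beta> \<in> D" "\<gamma> \<in> D" "(\<beta>, \<gamma>) \<in> r" for \<beta> \<gamma>
    using that tr unfolding T_def by blast
  have fst_D': "\<exists>\<alpha>\<in>D. fst x = e \<alpha>" if "x \<in> D'" for x
    using that by (auto simp: D'_def T_def)
  have "directed_on D' r'"
    unfolding directed_on_def
  proof (intro conjI ballI impI)
    show "D' \<noteq> {}" using dir in_D' by (auto simp: directed_on_def)
    fix x y assume "x \<in> D'" "y \<in> D'"
    then obtain \<beta> \<gamma> where bg: "\<beta> \<in> D" "\<gamma> \<in> D" "snd x = T \<beta>" "snd y = T \<gamma>"
      by (auto simp: D'_def)
    obtain \<delta> where "\<delta> \<in> D" "(\<beta>, \<delta>) \<in> r" "(\<gamma>, \<delta>) \<in> r"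
      using dir bg unfolding directed_on_def by blast
    then show "\<exists>z\<in>D'. (x, z) \<in> r' \<and> (y, z) \<in> r'"
      using bg T_mono in_D' by (intro bexI[of _ "(e \<delta>, T \<delta>)"]) (auto simp: r'_def)
  qed (auto simp: r'_def)
  moreover have "\<forall>x\<in>D'. fst x \<in> carrier (bidual A)"
    using assms fst_D' by (fastforce simp: ultra_central_approx_identity_def)
  moreover have "\<forall>a\<in>carrier A. \<forall>x\<in>D'. lact (bidual A) a (fst x) = ract (bidual A) (fst x) a"
  proof (intro ballI)
    fix a x assume "a \<in> carrier A" "x \<in> D'"
    moreover from fst_D'[OF \<open>x \<in> D'\<close>] obtain \<alpha> where "\<alpha> \<in> D" "fst x = e \<alpha>" by blast
    ultimately show "lact (bidual A) a (fst x) = ract (bidual A) (fst x) a"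
      using assms by (simp add: ultra_central_approx_identity_def)
  qed
  moreover have "\<exists>y\<in>D'. \<forall>x\<in>D'. (y, x) \<in> r' \<longrightarrow>
      vnorm (bidual A) (vdiff (bidual A) (ract (bidual A) (fst x) a) (bidual_embed A a)) < \<epsilon>"
    if a: "a \<in> carrier A" and eps: "\<epsilon> > 0" for a \<epsilon>
  proof -
    obtain \<beta> where b: "\<beta> \<in> D" "\<And>\<alpha>. \<alpha> \<in> D \<Longrightarrow> (\<beta>, \<alpha>) \<in> r \<Longrightarrow>
        vnorm (bidual A) (vdiff (bidual A) (ract (bidual A) (e \<alpha>) a) (bidual_embed A a)) < \<epsilon>"
      using assms a eps unfolding ultra_central_approx_identity_def by blast
    show ?thesis
    proof (intro bexI[of _ "(e \<beta>, T \<beta>)"] ballI impI)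
      fix x assume "x \<in> D'" "((e \<beta>, T \<beta>), x) \<in> r'"
      then have "fst x \<in> T \<beta>" by (auto simp: D'_def r'_def)
      then obtain \<alpha> where "\<alpha> \<in> D" "(\<beta>, \<alpha>) \<in> r" "fst x = e \<alpha>" by (auto simp: T_def)
      then show "vnorm (bidual A)
          (vdiff (bidual A) (ract (bidual A) (fst x) a) (bidual_embed A a)) < \<epsilon>"
        using b(2) by simp
    qed (use b in_D' in blast)
  qed
  ultimately have "ultra_central_approx_identity A D' r' fst"
    unfolding ultra_central_approx_identity_def by blast
  then show ?thesis unfolding has_ultra_central_approx_identity_def by blast
qed

text \<open>
  Elements of \<open>\<ell>\<^sup>1(S)\<close> are functions on the ambient type that vanish off \<open>S\<close>.
\<close>

definition l1_algebra :: "'s set \<Rightarrow> ('s \<Rightarrow> 's \<Rightarrow> 's) \<Rightarrow> ('s \<Rightarrow> complex) cnalgebra" where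
  "l1_algebra S m = \<lparr>
     carrier = {f. (\<forall>s. s \<notin> S \<longrightarrow> f s = 0) \<and> f abs_summable_on S},
     vadd = (\<lambda>f g s. f s + g s),
     vscale = (\<lambda>c f s. c * f s),
     vnorm = (\<lambda>f. \<Sum>\<^sub>\<infinity>s\<in>S. cmod (f s)),
     amult = (\<lambda>f g s. \<Sum>\<^sub>\<infinity>(t, u)\<in>{(t, u). t \<in> S \<and> u \<in> S \<and> m t u = s}. f t * g u)\<rparr>"

lemma l1_algebra_mult_delta:
  assumes "s \<in> S" "t \<in> S"
  shows "amult (l1_algebra S m) (\<lambda>x. of_bool (x = s)) (\<lambda>x. of_bool (x = t)) =
    (\<lambda>x. of_bool (x = m s t))"
proof
  fix x
  let ?P = "{(p, q). p \<in> S \<and> q \<in> S \<and> m p q = x}"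
  let ?f = "\<lambda>(p, q). of_bool (p = s) * of_bool (q = t) :: complex"
  have "infsum ?f ?P = infsum ?f (?P \<inter> {(s, t)})"
    by (rule infsum_cong_neutral) auto
  also have "\<dots> = of_bool (x = m s t)"
    using assms by (cases "x = m s t") (auto simp: Int_insert_right)
  finally show "amult (l1_algebra S m) (\<lambda>x. of_bool (x = s)) (\<lambda>x. of_bool (x = t)) x =
      of_bool (x = m s t)"
    by (simp add: l1_algebra_def)
qed

end

theory Submission imports Defs
begin

text \<open>
  Write \<open>1\<^sub>i\<^sub>j\<close> for \<open>Entry \<one> i j\<close>, and let a functional \<open>\<phi>\<^sub>s\<close> on \<open>\<ell>\<^sup>1(S)\<close> read off the
  value at \<open>s\<close>.

  If \<open>I\<close> has \<open>n\<close> elements, then the sum of the point masses at the \<open>1\<^sub>i\<^sub>i\<close>, minus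
  \<open>n - 1\<close> times the point mass at \<open>Zero\<close>, is an identity of \<open>\<ell>\<^sup>1(S)\<close>
  (\<open>brandt_identity_point_mass\<close>); its image in the bidual is, as a constant net, an ultra
  central approximate identity.

  Conversely, let \<open>M\<close> be a member of such a net. Centrality says that the point mass
  \<open>\<delta>\<close> at \<open>1\<^sub>i\<^sub>j\<close> satisfies \<open>\<delta> \<cdot> M = M \<cdot> \<delta>\<close>. The only solution of
  \<open>1\<^sub>i\<^sub>j u = 1\<^sub>i\<^sub>j\<close> is \<open>u = 1\<^sub>j\<^sub>j\<close>, and the only solution of \<open>u 1\<^sub>i\<^sub>j = 1\<^sub>i\<^sub>j\<close> is
  \<open>u = 1\<^sub>i\<^sub>i\<close>; so evaluating the two sides at the functional \<open>\<phi>\<close> for \<open>1\<^sub>i\<^sub>j\<close> shows that \<open>M\<close>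
  has the same value \<open>c\<close> at the functionals for \<open>1\<^sub>j\<^sub>j\<close> and for \<open>1\<^sub>i\<^sub>i\<close>. A sum of
  finitely many distinct \<open>\<phi>\<^sub>s\<close> has norm at most \<open>1\<close>, hence \<open>m \<bar>c\<bar> \<le> \<parallel>M\<parallel>\<close> whenever \<open>I\<close> has
  \<open>m\<close> distinct elements. But \<open>c\<close> is close to \<open>1\<close> as soon as \<open>M\<close> is far enough along
  the net to approximate the identity at the point mass of one \<open>1\<^sub>i\<^sub>i\<close>, and then \<open>I\<close> has
  at most \<open>\<parallel>M\<parallel> / \<bar>c\<bar>\<close> elements (\<open>finite_if_linked\<close>).

  The analytic groundwork is that a bounded bimodule has a bounded dual
  (\<open>bounded_bimod_dual\<close>), which yields the bidual of an algebra by dualising twice, and that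
  convolution on \<open>\<ell>\<^sup>1(S)\<close> is submultiplicative (\<open>vnorm_amult_l1\<close>).
\<close>

section \<open>Duals of bounded bimodules\<close>

definition bounded_operator :: "('x, 'm) cnspace_scheme \<Rightarrow> ('x \<Rightarrow> 'x) \<Rightarrow> bool" where
  "bounded_operator X T \<longleftrightarrow>
     (\<forall>x\<in>carrier X. T x \<in> carrier X) \<and>
     (\<forall>x\<in>carrier X. \<forall>y\<in>carrier X. T (vadd X x y) = vadd X (T x) (T y)) \<and>
     (\<forall>c. \<forall>x\<in>carrier X. T (vscale X c x) = vscale X c (T x)) \<and>
     (\<exists>K. \<forall>x\<in>carrier X. vnorm X (T x) \<le> K * vnorm X x)"

text \<open>
  The cut-off keeps the adjoint inside the dual, whose elements vanish off the carrier.
\<close>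

definition adjoint ::
  "('x, 'm) cnspace_scheme \<Rightarrow> ('x \<Rightarrow> 'x) \<Rightarrow> ('x \<Rightarrow> complex) \<Rightarrow> 'x \<Rightarrow> complex" where
  "adjoint X T f = (\<lambda>x. if x \<in> carrier X then f (T x) else 0)"

text \<open>
  These conditions are what duality reproduces: they make the dual norm a genuine bound for
  functionals, and they hold again for the dual.
\<close>

locale bounded_bimod =
  fixes R :: "'a set" and X :: "('a, 'x) bimod"
  assumes carrier_nonempty: "carrier X \<noteq> {}"
    and vadd_closed: "\<lbrakk>x \<in> carrier X; y \<in> carrier X\<rbrakk> \<Longrightarrow> vadd X x y \<in> carrier X"
    and vscale_closed: "x \<in> carrier X \<Longrightarrow> vscale X c x \<in> carrier X"
    and vnorm_nonneg: "x \<in> carrier X \<Longrightarrow> 0 \<le> vnorm X x"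
    and vnorm_vscale_le: "x \<in> carrier X \<Longrightarrow> vnorm X (vscale X c x) \<le> cmod c * vnorm X x"
    and lact_bounded: "a \<in> R \<Longrightarrow> bounded_operator X (lact X a)"
    and ract_bounded: "a \<in> R \<Longrightarrow> bounded_operator X (\<lambda>x. ract X x a)"

lemma dual_carrierI:
  assumes "\<And>x. x \<notin> carrier X \<Longrightarrow> f x = 0"
    and "\<And>x y. \<lbrakk>x \<in> carrier X; y \<in> carrier X\<rbrakk> \<Longrightarrow> f (vadd X x y) = f x + f y"
    and "\<And>c x. x \<in> carrier X \<Longrightarrow> f (vscale X c x) = c * f x"
    and "\<And>x. x \<in> carrier X \<Longrightarrow> cmod (f x) \<le> K * vnorm X x"
  shows "f \<in> dual_carrier X"
  using assms unfolding dual_carrier_def by blast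

lemma dual_carrierD:
  assumes "f \<in> dual_carrier X"
  shows "x \<notin> carrier X \<Longrightarrow> f x = 0"
    and "\<lbrakk>x \<in> carrier X; y \<in> carrier X\<rbrakk> \<Longrightarrow> f (vadd X x y) = f x + f y"
    and "x \<in> carrier X \<Longrightarrow> f (vscale X c x) = c * f x"
  using assms by (auto simp: dual_carrier_def)

lemma carrier_dual_bimod [simp]: "carrier (dual_bimod X) = dual_carrier X"
  by (simp add: dual_bimod_def)

lemma lact_dual_bimod: "lact (dual_bimod X) a = adjoint X (\<lambda>x. ract X x a)"
  by (auto simp: dual_bimod_def adjoint_def fun_eq_iff)

lemma ract_dual_bimod: "ract (dual_bimod X) f a = adjoint X (lact X a) f"
  by (auto simp: dual_bimod_def adjoint_def fun_eq_iff)

context bounded_bimod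
begin

lemma bdd_above_dual:
  assumes "f \<in> dual_carrier X"
  shows "bdd_above ((\<lambda>x. cmod (f x)) ` {x\<in>carrier X. vnorm X x \<le> 1})"
proof -
  obtain K where K: "cmod (f x) \<le> K * vnorm X x" if "x \<in> carrier X" for x
    using assms unfolding dual_carrier_def by blast
  have "cmod (f x) \<le> \<bar>K\<bar>" if "x \<in> carrier X" "vnorm X x \<le> 1" for x
  proof -
    have "cmod (f x) \<le> \<bar>K\<bar> * vnorm X x"
      using K[OF that(1)] mult_right_mono[OF abs_ge_self vnorm_nonneg[OF that(1)]] by (rule order_trans)
    also have "\<dots> \<le> \<bar>K\<bar>" using that(2) by (simp add: mult_left_le)
    finally show ?thesis .
  qed
  then show ?thesis by (intro bdd_aboveI2) auto
qed

lemma unit_ball_nonempty: "{x\<in>carrier X. vnorm X x \<le> 1} \<noteq> {}"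
proof -
  obtain x where x: "x \<in> carrier X" using carrier_nonempty by blast
  then have "vnorm X (vscale X 0 x) \<le> 1" using vnorm_vscale_le[of x 0] by simp
  then show ?thesis using vscale_closed[OF x] by blast
qed

lemma dual_norm_le:
  assumes "\<And>x. x \<in> carrier X \<Longrightarrow> cmod (f x) \<le> K * vnorm X x" and "0 \<le> K"
  shows "dual_norm X f \<le> K"
  unfolding dual_norm_def
proof (rule cSUP_least[OF unit_ball_nonempty])
  fix x assume "x \<in> {x\<in>carrier X. vnorm X x \<le> 1}"
  then have "cmod (f x) \<le> K * vnorm X x" "K * vnorm X x \<le> K * 1"
    using assms by (blast, intro mult_left_mono) auto
  then show "cmod (f x) \<le> K" by simp
qed

lemma dual_norm_nonneg:
  assumes "f \<in> dual_carrier X"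
  shows "0 \<le> dual_norm X f"
proof -
  obtain x where "x \<in> {x\<in>carrier X. vnorm X x \<le> 1}" using unit_ball_nonempty by blast
  then show ?thesis
    unfolding dual_norm_def by (rule cSUP_upper2[OF bdd_above_dual[OF assms]]) simp
qed

lemma cmod_dual_le:
  assumes f: "f \<in> dual_carrier X" and x: "x \<in> carrier X"
  shows "cmod (f x) \<le> dual_norm X f * vnorm X x"
proof (cases "vnorm X x = 0")
  case True
  then show ?thesis using f x by (auto simp: dual_carrier_def)
next
  case False
  then have pos: "0 < vnorm X x" using vnorm_nonneg[OF x] by simp
  define c :: complex where "c = of_real (inverse (vnorm X x))"
  have "vnorm X (vscale X c x) \<le> 1"
    using vnorm_vscale_le[OF x, of c] pos by (simp add: c_def norm_inverse)
  then have "cmod (f (vscale X c x)) \<le> dual_norm X f"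
    unfolding dual_norm_def
    by (intro cSUP_upper[OF _ bdd_above_dual[OF f]]) (simp add: vscale_closed x)
  moreover have "f (vscale X c x) = c * f x" using f x by (simp add: dual_carrier_def)
  moreover have "cmod c = inverse (vnorm X x)" using pos by (simp add: c_def norm_inverse)
  ultimately have "inverse (vnorm X x) * cmod (f x) \<le> dual_norm X f" by (simp add: norm_mult)
  then show ?thesis using pos by (simp add: field_simps)
qed

text \<open>
  The second part bounds the operator norm of the adjoint by any nonnegative bound for \<open>T\<close>; it is what
  makes the dual actions bounded again.
\<close>

lemma adjoint_dual:
  assumes T: "bounded_operator X T" and f: "f \<in> dual_carrier X"
  shows "adjoint X T f \<in> dual_carrier X"
    and "\<lbrakk>\<And>x. x \<in> carrier X \<Longrightarrow> vnorm X (T x) \<le> K * vnorm X x; 0 \<le> K\<rbrakk> \<Longrightarrow>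
         dual_norm X (adjoint X T f) \<le> K * dual_norm X f"
proof -
  have bound: "cmod (adjoint X T f x) \<le> (K * dual_norm X f) * vnorm X x"
    if K: "\<And>x. x \<in> carrier X \<Longrightarrow> vnorm X (T x) \<le> K * vnorm X x" and x: "x \<in> carrier X"
    for K x
  proof -
    have "cmod (f (T x)) \<le> dual_norm X f * vnorm X (T x)"
      using cmod_dual_le f T x by (simp add: bounded_operator_def)
    also have "\<dots> \<le> dual_norm X f * (K * vnorm X x)"
      using K[OF x] dual_norm_nonneg[OF f] by (rule mult_left_mono)
    finally show ?thesis using x by (simp add: adjoint_def mult_ac)
  qed
  obtain K' where "\<And>x. x \<in> carrier X \<Longrightarrow> vnorm X (T x) \<le> K' * vnorm X x"
    using T unfolding bounded_operator_def by blast
  from bound[OF this] show "adjoint X T f \<in> dual_carrier X"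
    using T dual_carrierD[OF f]
    by (intro dual_carrierI) (auto simp: bounded_operator_def adjoint_def vadd_closed vscale_closed)
  show "dual_norm X (adjoint X T f) \<le> K * dual_norm X f"
    if "\<And>x. x \<in> carrier X \<Longrightarrow> vnorm X (T x) \<le> K * vnorm X x" "0 \<le> K"
    using bound[OF that(1)] that(2) dual_norm_nonneg[OF f] by (intro dual_norm_le) auto
qed

lemma bounded_operator_adjoint:
  assumes T: "bounded_operator X T"
  shows "bounded_operator (dual_bimod X) (adjoint X T)"
proof -
  obtain K where K: "\<And>x. x \<in> carrier X \<Longrightarrow> vnorm X (T x) \<le> K * vnorm X x"
    using T unfolding bounded_operator_def by blast
  have "vnorm X (T x) \<le> \<bar>K\<bar> * vnorm X x" if "x \<in> carrier X" for x
    using K[OF that] mult_right_mono[OF abs_ge_self vnorm_nonneg[OF that]] by (rule order_trans)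
  from adjoint_dual(2)[OF T _ this]
  have "dual_norm X (adjoint X T f) \<le> \<bar>K\<bar> * dual_norm X f" if "f \<in> dual_carrier X" for f
    using that by simp
  then show ?thesis
    using adjoint_dual(1)[OF T]
    by (auto simp: bounded_operator_def dual_bimod_def) (auto simp: adjoint_def fun_eq_iff)
qed

lemma dual_carrier_add:
  assumes f: "f \<in> dual_carrier X" and g: "g \<in> dual_carrier X"
  shows "(\<lambda>x. f x + g x) \<in> dual_carrier X"
proof -
  have "cmod (f x + g x) \<le> (dual_norm X f + dual_norm X g) * vnorm X x" if "x \<in> carrier X" for x
    using norm_triangle_ineq[of "f x" "g x"] cmod_dual_le[OF f that] cmod_dual_le[OF g that]
    by (simp add: distrib_right)
  from dual_carrierI[OF _ _ _ this] show ?thesis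
    using dual_carrierD[OF f] dual_carrierD[OF g] by (simp add: algebra_simps)
qed

lemma cmod_scaled_dual_le:
  assumes f: "f \<in> dual_carrier X" and "x \<in> carrier X"
  shows "cmod (c * f x) \<le> (cmod c * dual_norm X f) * vnorm X x"
  using mult_left_mono[OF cmod_dual_le[OF assms] norm_ge_zero[of c]] by (simp add: norm_mult mult_ac)

lemma dual_carrier_scale:
  assumes f: "f \<in> dual_carrier X"
  shows "(\<lambda>x. c * f x) \<in> dual_carrier X"
  using dual_carrierD[OF f]
  by (intro dual_carrierI[OF _ _ _ cmod_scaled_dual_le[OF f]]) (auto simp: algebra_simps)

lemma zero_dual: "(\<lambda>x. 0) \<in> dual_carrier X" "dual_norm X (\<lambda>x. 0) = 0"
proof -
  show z: "(\<lambda>x. 0) \<in> dual_carrier X" by (rule dual_carrierI[where K = 0]) auto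
  show "dual_norm X (\<lambda>x. 0) = 0"
    using dual_norm_le[of "\<lambda>x. 0" 0] dual_norm_nonneg[OF z] by simp
qed

text \<open>
  The dual actions are the adjoints of the opposite actions, so their boundedness is that of
  adjoint operators.
\<close>

theorem bounded_bimod_dual: "bounded_bimod R (dual_bimod X)"
proof
  show "bounded_operator (dual_bimod X) (lact (dual_bimod X) a)" if "a \<in> R" for a
    using bounded_operator_adjoint[OF ract_bounded[OF that]] by (simp add: lact_dual_bimod)
  show "bounded_operator (dual_bimod X) (\<lambda>f. ract (dual_bimod X) f a)" if "a \<in> R" for a
    using bounded_operator_adjoint[OF lact_bounded[OF that]] by (simp add: ract_dual_bimod)
  show "carrier (dual_bimod X) \<noteq> {}" using zero_dual by auto
  show "vnorm (dual_bimod X) (vscale (dual_bimod X) c f) \<le> cmod c * vnorm (dual_bimod X) f"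
    if "f \<in> carrier (dual_bimod X)" for c f
    using that cmod_scaled_dual_le dual_norm_nonneg
    by (auto simp: dual_bimod_def intro!: dual_norm_le)
qed (auto simp: dual_bimod_def dual_carrier_add dual_carrier_scale dual_norm_nonneg)

end

section \<open>Central elements of the bidual of an algebra\<close>

lemma self_bimod_simps [simp]:
  "carrier (self_bimod A) = carrier A"
  "lact (self_bimod A) = amult A"
  "ract (self_bimod A) = amult A"
  by (simp_all add: self_bimod_def)

locale bounded_algebra =
  fixes A :: "'a cnalgebra"
  assumes bounded_self: "bounded_bimod (carrier A) (self_bimod A)"
begin

sublocale self: bounded_bimod "carrier A" "self_bimod A" by (rule bounded_self)
sublocale dual: bounded_bimod "carrier A" "dual_bimod (self_bimod A)"
  by (rule self.bounded_bimod_dual)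
sublocale bidual: bounded_bimod "carrier A" "bidual A"
  unfolding bidual_def by (rule dual.bounded_bimod_dual)

abbreviation "A_dual \<equiv> dual_carrier (self_bimod A)"

lemma carrier_bidual: "carrier (bidual A) = dual_carrier (dual_bimod (self_bimod A))"
  by (simp add: bidual_def)

lemma lact_bidual:
  "lact (bidual A) a M = (\<lambda>f. if f \<in> A_dual then M (adjoint (self_bimod A) (amult A a) f) else 0)"
  by (simp add: bidual_def lact_dual_bimod ract_dual_bimod adjoint_def[of "dual_bimod _"])

lemma ract_bidual:
  "ract (bidual A) M a =
     (\<lambda>f. if f \<in> A_dual then M (adjoint (self_bimod A) (\<lambda>x. amult A x a) f) else 0)"
  by (simp add: bidual_def lact_dual_bimod ract_dual_bimod adjoint_def[of "dual_bimod _"])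

lemma amult_bounded:
  assumes "a \<in> carrier A"
  shows "bounded_operator (self_bimod A) (amult A a)"
    and "bounded_operator (self_bimod A) (\<lambda>x. amult A x a)"
  using self.lact_bounded[OF assms] self.ract_bounded[OF assms] by (simp_all add: self_bimod_def)

lemma bidual_embed_carrier:
  assumes a: "a \<in> carrier A"
  shows "bidual_embed A a \<in> carrier (bidual A)"
proof -
  have "cmod (f a) \<le> vnorm A a * dual_norm (self_bimod A) f" if "f \<in> A_dual" for f
    using self.cmod_dual_le[OF that, of a] a by (simp add: self_bimod_def mult.commute)
  then show ?thesis
    using a self.dual_carrier_add self.dual_carrier_scale
    by (auto simp: carrier_bidual dual_carrier_def[of "dual_bimod _"] bidual_embed_def)
       (auto simp: dual_bimod_def)
qed

lemma act_bidual_embed: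
  assumes a: "a \<in> carrier A" and b: "b \<in> carrier A"
  shows "lact (bidual A) a (bidual_embed A b) = bidual_embed A (amult A a b)"
    and "ract (bidual A) (bidual_embed A b) a = bidual_embed A (amult A b a)"
  using self.adjoint_dual(1)[OF amult_bounded(1)[OF a]]
    self.adjoint_dual(1)[OF amult_bounded(2)[OF a]] b
  by (auto simp: lact_bidual ract_bidual bidual_embed_def adjoint_def fun_eq_iff)

text \<open>
  An identity \<open>u\<close> of the algebra becomes, in the bidual, a constant net whose limit is attained.
\<close>

lemma has_ultra_central_approx_identity_if_identity:
  assumes u: "u \<in> carrier A"
    and left: "\<And>a. a \<in> carrier A \<Longrightarrow> amult A u a = a"
    and right: "\<And>a. a \<in> carrier A \<Longrightarrow> amult A a u = a"
  shows "has_ultra_central_approx_identity A"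
proof -
  have "vnorm (bidual A) (vdiff (bidual A) (bidual_embed A a) (bidual_embed A a)) = 0" for a
    using dual.zero_dual(2) by (simp add: vdiff_def bidual_def dual_bimod_def)
  then have "ultra_central_approx_identity A {()} {((), ())} (\<lambda>_. bidual_embed A u)"
    using assms bidual_embed_carrier
    by (simp add: ultra_central_approx_identity_def directed_on_def act_bidual_embed)
  then show ?thesis by (rule has_ultra_central_approx_identityI)
qed

text \<open>
  This is how an approximate identity is used: one member of the net, good enough at one element
  \<open>a\<close>. Norm convergence in the bidual becomes an estimate at each functional.
\<close>

lemma central_approximation:
  assumes "has_ultra_central_approx_identity A" and a: "a \<in> carrier A" and "0 < \<epsilon>"
  obtains M where "M \<in> carrier (bidual A)"
    and "\<And>b. b \<in> carrier A \<Longrightarrow> lact (bidual A) b M = ract (bidual A) M b"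
    and "\<And>f. f \<in> A_dual \<Longrightarrow>
           cmod (ract (bidual A) M a f - f a) \<le> \<epsilon> * dual_norm (self_bimod A) f"
proof -
  obtain D r and e :: "(('a \<Rightarrow> complex) \<Rightarrow> complex) \<times> (('a \<Rightarrow> complex) \<Rightarrow> complex) set
      \<Rightarrow> ('a \<Rightarrow> complex) \<Rightarrow> complex"
    where e: "ultra_central_approx_identity A D r e"
    using assms(1) by (auto simp: has_ultra_central_approx_identity_def)
  obtain \<beta> where \<beta>: "\<beta> \<in> D" "\<And>\<alpha>. \<alpha> \<in> D \<Longrightarrow> (\<beta>, \<alpha>) \<in> r \<Longrightarrow>
      vnorm (bidual A) (vdiff (bidual A) (ract (bidual A) (e \<alpha>) a) (bidual_embed A a)) < \<epsilon>"
    using e a \<open>0 < \<epsilon>\<close> unfolding ultra_central_approx_identity_def by blast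
  have "(\<beta>, \<beta>) \<in> r"
    using e \<beta>(1) by (simp add: ultra_central_approx_identity_def directed_on_def)
  define N where "N = vdiff (bidual A) (ract (bidual A) (e \<beta>) a) (bidual_embed A a)"
  have eb: "e \<beta> \<in> carrier (bidual A)"
    using e \<beta>(1) by (simp add: ultra_central_approx_identity_def)
  have N: "N \<in> carrier (bidual A)"
    using bidual.ract_bounded[OF a] eb bidual_embed_carrier[OF a]
    by (simp add: N_def vdiff_def bounded_operator_def bidual.vadd_closed bidual.vscale_closed)
  have small: "dual_norm (dual_bimod (self_bimod A)) N < \<epsilon>"
    using \<beta>(2)[OF \<beta>(1) \<open>(\<beta>, \<beta>) \<in> r\<close>] by (simp add: N_def bidual_def dual_bimod_def)
  show thesis
  proof
    show "e \<beta> \<in> carrier (bidual A)" by (rule eb)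
    show "lact (bidual A) b (e \<beta>) = ract (bidual A) (e \<beta>) b" if "b \<in> carrier A" for b
      using e \<beta>(1) that by (simp add: ultra_central_approx_identity_def)
    fix f assume f: "f \<in> A_dual"
    have "cmod (N f) \<le> dual_norm (dual_bimod (self_bimod A)) N * dual_norm (self_bimod A) f"
      using dual.cmod_dual_le[of N f] N f by (simp add: carrier_bidual) (simp add: dual_bimod_def)
    also have "\<dots> \<le> \<epsilon> * dual_norm (self_bimod A) f"
      using small self.dual_norm_nonneg[OF f] by (intro mult_right_mono) auto
    finally have "cmod (N f) \<le> \<epsilon> * dual_norm (self_bimod A) f" .
    moreover have "N f = ract (bidual A) (e \<beta>) a f - f a"
      using f by (simp add: N_def vdiff_def bidual_embed_def) (simp add: bidual_def dual_bimod_def)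
    ultimately show "cmod (ract (bidual A) (e \<beta>) a f - f a) \<le> \<epsilon> * dual_norm (self_bimod A) f" 
      by simp
  qed
qed

end


section \<open>Convolution on absolutely summable functions\<close>

lemma l1_algebra_simps:
  "carrier (l1_algebra S m) = {f. (\<forall>s. s \<notin> S \<longrightarrow> f s = 0) \<and> f abs_summable_on S}"
  "vadd (l1_algebra S m) = (\<lambda>f g s. f s + g s)"
  "vscale (l1_algebra S m) = (\<lambda>c f s. c * f s)"
  "vnorm (l1_algebra S m) = (\<lambda>f. \<Sum>\<^sub>\<infinity>s\<in>S. cmod (f s))"
  "amult (l1_algebra S m) =
     (\<lambda>f g s. \<Sum>\<^sub>\<infinity>(t, u)\<in>{(t, u). t \<in> S \<and> u \<in> S \<and> m t u = s}. f t * g u)"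
  by (simp_all add: l1_algebra_def)

lemma abs_summable_tensor:
  fixes f g :: "'s \<Rightarrow> complex"
  assumes "f abs_summable_on S" and "g abs_summable_on S"
  shows "(\<lambda>(t, u). f t * g u) abs_summable_on S \<times> S"
    and "(\<Sum>\<^sub>\<infinity>(t, u)\<in>S \<times> S. cmod (f t * g u)) = (\<Sum>\<^sub>\<infinity>t\<in>S. cmod (f t)) * (\<Sum>\<^sub>\<infinity>u\<in>S. cmod (g u))"
proof -
  show *: "(\<lambda>(t, u). f t * g u) abs_summable_on S \<times> S"
    using assms
    by (subst abs_summable_on_Sigma_iff)
       (auto simp: norm_mult infsum_cmult_right' abs_mult infsum_nonneg intro!: summable_on_cmult_right summable_on_cmult_left)
  have "(\<Sum>\<^sub>\<infinity>(t, u)\<in>S \<times> S. cmod (f t * g u)) = (\<Sum>\<^sub>\<infinity>t\<in>S. \<Sum>\<^sub>\<infinity>u\<in>S. cmod (f t * g u))"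
    using infsum_Sigma_banach[of "\<lambda>p. cmod (case p of (t, u) \<Rightarrow> f t * g u)" S "\<lambda>_. S"] *
    by (simp add: case_prod_unfold)
  then show "(\<Sum>\<^sub>\<infinity>(t, u)\<in>S \<times> S. cmod (f t * g u)) = (\<Sum>\<^sub>\<infinity>t\<in>S. cmod (f t)) * (\<Sum>\<^sub>\<infinity>u\<in>S. cmod (g u))"
    by (simp add: norm_mult infsum_cmult_right' infsum_cmult_left')
qed

text \<open>
  Convolution over the opposite operation is convolution with its arguments exchanged, so each
  statement about one side of the algebra also gives the one about the other side.
\<close>

lemma amult_l1_swap:
  "amult (l1_algebra S m) f g = amult (l1_algebra S (\<lambda>s t. m t s)) g f"
proof
  fix s
  have "bij_betw prod.swap {(t, u). t \<in> S \<and> u \<in> S \<and> m t u = s}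
          {(t, u). t \<in> S \<and> u \<in> S \<and> m u t = s}"
    by (rule bij_betw_byWitness[where f' = prod.swap]) auto
  from infsum_reindex_bij_betw[OF this, of "\<lambda>(t, u). g t * f u"]
  show "amult (l1_algebra S m) f g s = amult (l1_algebra S (\<lambda>s t. m t s)) g f s"
    by (simp add: l1_algebra_simps case_prod_unfold mult.commute)
qed

locale closed_operation =
  fixes S :: "'s set" and m :: "'s \<Rightarrow> 's \<Rightarrow> 's"
  assumes closed: "\<lbrakk>s \<in> S; t \<in> S\<rbrakk> \<Longrightarrow> m s t \<in> S"
begin

abbreviation "A \<equiv> l1_algebra S m"

abbreviation "factorisations s \<equiv> {(t, u). t \<in> S \<and> u \<in> S \<and> m t u = s}"

text \<open>
  All three facts come from one rearrangement: the sets of factorisations partition \<open>S \<times> S\<close>, over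
  which \<open>\<lambda>(t, u). f t * g u\<close> is absolutely summable with sum of moduli the product of the norms.
\<close>

lemma
  assumes f: "f \<in> carrier A" and g: "g \<in> carrier A"
  shows summable_factorisations: "(\<lambda>(t, u). f t * g u) abs_summable_on factorisations s"
    and amult_l1_closed: "amult A f g \<in> carrier A"
    and vnorm_amult_l1: "vnorm A (amult A f g) \<le> vnorm A f * vnorm A g"
proof -
  define h where "h = (\<lambda>(t, u). f t * g u)"
  have fg: "f abs_summable_on S" "g abs_summable_on S" using f g by (simp_all add: l1_algebra_simps)
  have bij: "bij_betw snd (Sigma S factorisations) (S \<times> S)"
    by (rule bij_betw_byWitness[where f' = "\<lambda>(t, u). (m t u, (t, u))"]) (auto simp: closed)
  have sum: "(\<lambda>p. h (snd p)) abs_summable_on Sigma S factorisations"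
    using abs_summable_tensor(1)[OF fg] summable_on_reindex_bij_betw[OF bij, of "\<lambda>p. norm (h p)"]
    by (simp add: h_def)
  then have fib: "h abs_summable_on factorisations s" if "s \<in> S" for s
    using that unfolding abs_summable_on_Sigma_iff by auto
  have outer: "(\<lambda>s. infsum (\<lambda>p. cmod (h p)) (factorisations s)) summable_on S"
    using sum unfolding abs_summable_on_Sigma_iff by (simp add: infsum_nonneg)
  have le: "cmod (amult A f g s) \<le> infsum (\<lambda>p. cmod (h p)) (factorisations s)" if "s \<in> S" for s
    using norm_infsum_bound[OF fib[OF that]] by (simp add: l1_algebra_simps h_def)
  have off: "factorisations s = {}" if "s \<notin> S" for s using that closed by auto
  show "(\<lambda>(t, u). f t * g u) abs_summable_on factorisations s"
  proof (cases "s \<in> S")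
    case True
    then show ?thesis using fib by (simp add: h_def)
  next
    case False
    show ?thesis by (simp only: off[OF False] summable_on_empty)
  qed
  have abs: "amult A f g abs_summable_on S"
    by (rule abs_summable_on_comparison_test'[OF outer le])
  moreover have "amult A f g s = 0" if "s \<notin> S" for s
    by (simp only: l1_algebra_simps(5) off[OF that] infsum_empty)
  ultimately show "amult A f g \<in> carrier A" by (simp add: l1_algebra_simps(1))
  have "vnorm A (amult A f g) \<le> (\<Sum>\<^sub>\<infinity>s\<in>S. infsum (\<lambda>p. cmod (h p)) (factorisations s))"
    using infsum_mono[OF abs outer le] by (simp add: l1_algebra_simps(4))
  also have "\<dots> = infsum (\<lambda>p. cmod (h (snd p))) (Sigma S factorisations)"
    using infsum_Sigma_banach[OF sum] by simp
  also have "\<dots> = infsum (\<lambda>p. cmod (h p)) (S \<times> S)"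
    by (rule infsum_reindex_bij_betw[OF bij])
  also have "\<dots> = vnorm A f * vnorm A g"
    using abs_summable_tensor(2)[OF fg] by (simp add: h_def l1_algebra_simps case_prod_unfold)
  finally show "vnorm A (amult A f g) \<le> vnorm A f * vnorm A g" .
qed

lemma amult_l1_bounded:
  assumes f: "f \<in> carrier A"
  shows "bounded_operator (self_bimod A) (amult A f)"
proof -
  have "amult A f (vadd A g h) = vadd A (amult A f g) (amult A f h)"
    if "g \<in> carrier A" "h \<in> carrier A" for g h
  proof
    fix s
    show "amult A f (vadd A g h) s = vadd A (amult A f g) (amult A f h) s"
      using infsum_add[OF abs_summable_summable[OF summable_factorisations[OF f that(1), of s]]
          abs_summable_summable[OF summable_factorisations[OF f that(2), of s]]]
      by (simp add: l1_algebra_simps case_prod_unfold distrib_left)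
  qed
  moreover have "amult A f (vscale A c g) = vscale A c (amult A f g)" for c g
  proof
    fix s
    show "amult A f (vscale A c g) s = vscale A c (amult A f g) s"
      by (simp add: l1_algebra_simps case_prod_unfold mult.left_commute[of _ c] infsum_cmult_right')
  qed
  ultimately show ?thesis
    using amult_l1_closed[OF f] vnorm_amult_l1[OF f] unfolding bounded_operator_def
    by (intro conjI exI[of _ "vnorm A f"]) (simp_all add: self_bimod_def)
qed


lemma opposite_closed: "closed_operation S (\<lambda>s t. m t s)"
  by unfold_locales (rule closed)

sublocale bounded_algebra A
proof (unfold_locales, goal_cases)
  case 1 
  have "(\<lambda>_. 0) \<in> carrier A" by (simp add: l1_algebra_simps)
  then show ?case by (auto simp: self_bimod_def)
next
  case (2 f g)
  have "(\<lambda>s. cmod (f s) + cmod (g s)) summable_on S"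
    using 2 by (auto simp: self_bimod_def l1_algebra_simps intro: summable_on_add)
  then have "(\<lambda>s. f s + g s) abs_summable_on S"
    by (rule abs_summable_on_comparison_test') (rule norm_triangle_ineq)
  then show ?case using 2 by (simp add: self_bimod_def l1_algebra_simps)
next
  case (3 f c)
  then show ?case
    by (auto simp: self_bimod_def l1_algebra_simps norm_mult intro: summable_on_cmult_right)
next
  case (4 f)
  show ?case by (simp add: self_bimod_def l1_algebra_simps infsum_nonneg)
next
  case (5 f c)
  show ?case by (simp add: self_bimod_def l1_algebra_simps norm_mult infsum_cmult_right')
next
  case (6 f)
  then show ?case by (simp add: amult_l1_bounded)
next
  case (7 f)
  interpret opposite: closed_operation S "\<lambda>s t. m t s" by (rule opposite_closed)
  have "bounded_operator (self_bimod opposite.A) (amult opposite.A f)"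
    using 7 by (intro opposite.amult_l1_bounded) (simp add: l1_algebra_simps)
  moreover have "amult opposite.A f = (\<lambda>g. amult A g f)"
    by (rule ext) (rule amult_l1_swap[symmetric])
  moreover have "bounded_operator (self_bimod opposite.A) = bounded_operator (self_bimod A)"
    by (simp add: bounded_operator_def self_bimod_def l1_algebra_simps(1-4) fun_eq_iff)
  ultimately show ?case by simp
qed

section \<open>Coordinate functionals and point masses\<close>

text \<open>
  Singletons \<open>T\<close> give the coordinate functionals. The cut-off to the carrier puts the functional
  into the dual.
\<close>

definition coordinate_sum :: "'s set \<Rightarrow> ('s \<Rightarrow> complex) \<Rightarrow> complex" where
  "coordinate_sum T = (\<lambda>f. if f \<in> carrier A then \<Sum>s\<in>T. f s else 0)"

lemma cmod_coordinate_sum_le: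
  assumes "finite T" "T \<subseteq> S" and f: "f \<in> carrier A"
  shows "cmod (coordinate_sum T f) \<le> vnorm A f"
proof -
  have "cmod (\<Sum>s\<in>T. f s) \<le> (\<Sum>s\<in>T. cmod (f s))" by (rule norm_sum)
  also have "\<dots> \<le> (\<Sum>\<^sub>\<infinity>s\<in>S. cmod (f s))"
    using assms by (intro finite_sum_le_infsum) (auto simp: l1_algebra_simps)
  finally show ?thesis using f by (simp add: coordinate_sum_def l1_algebra_simps(4))
qed

text \<open>
  The bound \<open>1\<close> is independent of the size of \<open>T\<close>: the dual of \<open>\<ell>\<^sup>1\<close> carries the supremum norm.
\<close>

lemma coordinate_sum_dual:
  assumes "finite T" "T \<subseteq> S"
  shows "coordinate_sum T \<in> A_dual" and "dual_norm (self_bimod A) (coordinate_sum T) \<le> 1"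
proof -
  have *: "cmod (coordinate_sum T f) \<le> 1 * vnorm (self_bimod A) f"
    if "f \<in> carrier (self_bimod A)" for f
    using cmod_coordinate_sum_le[OF assms, of f] that by (simp add: self_bimod_def)
  then show "dual_norm (self_bimod A) (coordinate_sum T) \<le> 1"
    by (intro self.dual_norm_le) auto
  show "coordinate_sum T \<in> A_dual"
  proof (rule dual_carrierI[OF _ _ _ *])
    fix f g assume fg: "f \<in> carrier (self_bimod A)" "g \<in> carrier (self_bimod A)"
    then show "coordinate_sum T (vadd (self_bimod A) f g) = coordinate_sum T f + coordinate_sum T g"
      using self.vadd_closed[OF fg]
      by (simp add: coordinate_sum_def) (simp add: self_bimod_def l1_algebra_simps(2) sum.distrib)
  next
    fix c f assume f: "f \<in> carrier (self_bimod A)"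
    then show "coordinate_sum T (vscale (self_bimod A) c f) = c * coordinate_sum T f"
      using self.vscale_closed[OF f, of c]
      by (simp add: coordinate_sum_def) (simp add: self_bimod_def l1_algebra_simps(3) sum_distrib_left)
  qed (auto simp: coordinate_sum_def)
qed

lemma bidual_coordinate_sum:
  assumes M: "M \<in> carrier (bidual A)" and "finite T" "T \<subseteq> S"
  shows "M (coordinate_sum T) = (\<Sum>s\<in>T. M (coordinate_sum {s}))"
  using assms(2,3)
proof (induction T rule: finite_induct)
  case empty
  \<comment> \<open>The zero functional is written as a multiple of a functional, for \<open>M\<close> is homogeneous.\<close>
  have "M (\<lambda>f. 0 * coordinate_sum {} f) = 0 * M (coordinate_sum {})"
    using dual_carrierD(3)[OF M[unfolded carrier_bidual], of "coordinate_sum {}" 0]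
      coordinate_sum_dual(1)[of "{}"] by (simp add: dual_bimod_def)
  moreover have "coordinate_sum {} = (\<lambda>f. 0)" by (auto simp: coordinate_sum_def fun_eq_iff)
  ultimately show ?case by simp
next
  case (insert s T)
  have "M (\<lambda>f. coordinate_sum {s} f + coordinate_sum T f) =
      M (coordinate_sum {s}) + M (coordinate_sum T)"
    using dual_carrierD(2)[OF M[unfolded carrier_bidual], of "coordinate_sum {s}" "coordinate_sum T"]
      coordinate_sum_dual(1)[of "{s}"] coordinate_sum_dual(1)[of T] insert.hyps insert.prems
    by (simp add: dual_bimod_def)
  moreover have "(\<lambda>f. coordinate_sum {s} f + coordinate_sum T f) = coordinate_sum (insert s T)"
    using insert.hyps by (auto simp: coordinate_sum_def fun_eq_iff)
  ultimately show ?case using insert by simp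
qed

lemma amult_l1_single:
  assumes "t \<in> S" "u \<in> S"
    and "\<And>t' u'. \<lbrakk>t' \<in> S; u' \<in> S; m t' u' = m t u; (t', u') \<noteq> (t, u)\<rbrakk> \<Longrightarrow> f t' * g u' = 0"
  shows "amult A f g (m t u) = f t * g u"
proof -
  have "(\<Sum>\<^sub>\<infinity>(t', u')\<in>factorisations (m t u). f t' * g u') = (\<Sum>\<^sub>\<infinity>(t', u')\<in>{(t, u)}. f t' * g u')"
  proof (rule infsum_cong_neutral)
    fix p assume p: "p \<in> factorisations (m t u) - {(t, u)}"
    obtain t' u' where "p = (t', u')" by (cases p)
    then show "(case p of (t', u') \<Rightarrow> f t' * g u') = 0" using assms(3)[of t' u'] p by simp
  qed (use assms(1,2) in auto)
  then show ?thesis by (simp add: l1_algebra_simps)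
qed

abbreviation point_mass :: "'s \<Rightarrow> 's \<Rightarrow> complex" where
  "point_mass s \<equiv> (\<lambda>x. of_bool (x = s))"

lemma point_mass_carrier:
  assumes "s \<in> S"
  shows "point_mass s \<in> carrier A"
proof -
  have "(\<lambda>x. cmod (point_mass s x)) summable_on S \<longleftrightarrow> (\<lambda>x. cmod (point_mass s x)) summable_on {s}"
    using assms by (intro summable_on_cong_neutral) auto
  then show ?thesis using assms by (auto simp: l1_algebra_simps)
qed

text \<open>
  If \<open>v\<close> is the only solution of \<open>m s u = y\<close>, then convolving with the point mass at \<open>s\<close> carries
  the coordinate \<open>v\<close> to the coordinate \<open>y\<close>; the action on the bidual is dual to this.
\<close>

lemma lact_bidual_point_mass:
  assumes "s \<in> S" "v \<in> S" and v: "\<And>u. u \<in> S \<Longrightarrow> m s u = y \<longleftrightarrow> u = v"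
  shows "lact (bidual A) (point_mass s) M (coordinate_sum {y}) = M (coordinate_sum {v})"
proof -
  have y: "y = m s v" using v \<open>v \<in> S\<close> by blast
  have "amult A (point_mass s) f y = f v" for f
    using amult_l1_single[of s v "point_mass s" f] assms unfolding y by auto
  then have "adjoint (self_bimod A) (amult A (point_mass s)) (coordinate_sum {y}) = coordinate_sum {v}"
    using amult_l1_closed[OF point_mass_carrier[OF \<open>s \<in> S\<close>]]
    by (auto simp: adjoint_def coordinate_sum_def)
  then show ?thesis
    using coordinate_sum_dual(1)[of "{y}"] closed assms(1,2) y by (simp add: lact_bidual)
qed

lemma ract_bidual_point_mass:
  assumes "s \<in> S" "v \<in> S" and v: "\<And>u. u \<in> S \<Longrightarrow> m u s = y \<longleftrightarrow> u = v"
  shows "ract (bidual A) M (point_mass s) (coordinate_sum {y}) = M (coordinate_sum {v})"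
proof -
  have y: "y = m v s" using v \<open>v \<in> S\<close> by blast
  have "amult A f (point_mass s) y = f v" for f
    using amult_l1_single[of v s f "point_mass s"] assms unfolding y by auto
  then have "adjoint (self_bimod A) (\<lambda>f. amult A f (point_mass s)) (coordinate_sum {y}) =
      coordinate_sum {v}"
    using amult_l1_closed[OF _ point_mass_carrier[OF \<open>s \<in> S\<close>]]
    by (auto simp: adjoint_def coordinate_sum_def)
  then show ?thesis
    using coordinate_sum_dual(1)[of "{y}"] closed assms(1,2) y by (simp add: ract_bidual)
qed

text \<open>
  The element \<open>s\<close> of the last hypothesis links \<open>t\<close> to \<open>e\<close>: for a central \<open>M\<close>, comparing
  the two actions of the point mass at \<open>s\<close> at the coordinate \<open>y\<close> shows that \<open>M\<close> takes the same
  value \<open>c\<close> at the coordinates \<open>t\<close> and \<open>e\<close>. Summing over \<open>n\<close> elements of \<open>T\<close> gives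
  \<open>n \<bar>c\<bar> \<le> \<parallel>M\<parallel>\<close>, while approximation at the point mass of \<open>e\<close> keeps \<open>c\<close> away from \<open>0\<close>.
\<close>

lemma finite_if_linked:
  assumes uca: "has_ultra_central_approx_identity A"
    and e: "e \<in> S" "\<And>u. u \<in> S \<Longrightarrow> m u e = e \<longleftrightarrow> u = e"
    and T: "T \<subseteq> S"
    and linked: "\<And>t. t \<in> T \<Longrightarrow>
      \<exists>s\<in>S. \<exists>y. \<forall>u\<in>S. (m s u = y \<longleftrightarrow> u = t) \<and> (m u s = y \<longleftrightarrow> u = e)"
  shows "finite T"
proof (rule ccontr)
  assume inf: "infinite T"
  obtain M where M: "M \<in> carrier (bidual A)"
    and central: "\<And>b. b \<in> carrier A \<Longrightarrow> lact (bidual A) b M = ract (bidual A) M b"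
    and approx: "\<And>f. f \<in> A_dual \<Longrightarrow> cmod (ract (bidual A) M (point_mass e) f - f (point_mass e))
           \<le> 1 / 2 * dual_norm (self_bimod A) f"
    using central_approximation[OF uca point_mass_carrier[OF e(1)], of "1 / 2"] by auto
  define c where "c = M (coordinate_sum {e})"
  have "coordinate_sum {e} (point_mass e) = 1"
    using point_mass_carrier[OF e(1)] by (simp add: coordinate_sum_def)
  then have "cmod (c - 1) \<le> 1 / 2"
    using approx[of "coordinate_sum {e}"] coordinate_sum_dual[of "{e}"] e
      ract_bidual_point_mass[of e e e M]
    by (simp add: c_def)
  then have c: "1 / 2 \<le> cmod c"
    using norm_triangle_ineq2[of 1 "1 - c"] by (simp add: norm_minus_commute)
  have const: "M (coordinate_sum {t}) = c" if t: "t \<in> T" for t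
  proof -
    obtain s y where s: "s \<in> S" "\<And>u. u \<in> S \<Longrightarrow> m s u = y \<longleftrightarrow> u = t"
        "\<And>u. u \<in> S \<Longrightarrow> m u s = y \<longleftrightarrow> u = e"
      using linked[OF t] by blast
    have "M (coordinate_sum {t}) = lact (bidual A) (point_mass s) M (coordinate_sum {y})"
      using lact_bidual_point_mass[OF s(1) _ s(2)] t T by auto
    also have "\<dots> = ract (bidual A) M (point_mass s) (coordinate_sum {y})"
      by (simp add: central point_mass_carrier s(1))
    also have "\<dots> = c" using ract_bidual_point_mass[OF s(1) e(1) s(3)] by (simp add: c_def)
    finally show ?thesis .
  qed
  define K where "K = dual_norm (dual_bimod (self_bimod A)) M"
  \<comment> \<open>As \<open>\<bar>c\<bar> \<ge> 1 / 2\<close>, more than \<open>2 K\<close> elements of \<open>T\<close> are too many.\<close>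
  obtain n :: nat where n: "2 * K < real n" using reals_Archimedean2 by blast
  obtain F where F: "F \<subseteq> T" "finite F" "card F = n"
    using infinite_arbitrarily_large[OF inf] by blast
  then have FS: "F \<subseteq> S" using T by blast
  have "real n * cmod c = cmod (M (coordinate_sum F))"
    using bidual_coordinate_sum[OF M F(2) FS] const F by (simp add: subset_iff norm_mult)
  also have "\<dots> \<le> K * dual_norm (self_bimod A) (coordinate_sum F)"
    using dual.cmod_dual_le[of M "coordinate_sum F"] M coordinate_sum_dual(1)[OF F(2) FS]
    by (simp add: carrier_bidual K_def) (simp add: dual_bimod_def)
  also have "\<dots> \<le> K * 1"
    using M by (intro mult_left_mono coordinate_sum_dual F FS)
      (simp add: K_def carrier_bidual dual.dual_norm_nonneg)
  also have "\<dots> < real n / 2" using n by simp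
  finally have "real n * cmod c < real n / 2" .
  moreover have "real n * (1 / 2) \<le> real n * cmod c" using c by (rule mult_left_mono) simp
  ultimately show False by simp
qed

text \<open>
  By \<open>unit\<close>, \<open>e\<close> is a right identity for the point masses. Every \<open>a\<close> is the sum of its values
  times point masses, and convolution may be interchanged with this sum because the double series
  over \<open>S \<times> T\<close> converges absolutely.
\<close>

lemma amult_l1_right_identity:
  assumes T: "finite T" "T \<subseteq> S" and e: "e \<in> carrier A" "\<And>s. s \<notin> T \<Longrightarrow> e s = 0"
    and unit: "\<And>u y. \<lbrakk>u \<in> S; y \<in> S\<rbrakk> \<Longrightarrow> (\<Sum>t\<in>T. of_bool (m u t = y) * e t) = of_bool (u = y)"
    and a: "a \<in> carrier A"
  shows "amult A a e = a"
proof
  fix y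
  show "amult A a e y = a y"
  proof (cases "y \<in> S")
    case False
    then show ?thesis using amult_l1_closed[OF a e(1)] a by (simp add: l1_algebra_simps(1))
  next
    case True
    have support: "t \<in> T" if "e t \<noteq> 0" for t using e(2) that by blast
    define h where "h = (\<lambda>(u, t). a u * (of_bool (m u t = y) * e t))"
    have "(\<lambda>(u, t). a u * e t) abs_summable_on S \<times> S"
      using abs_summable_tensor(1)[of a S e] a e(1) by (simp add: l1_algebra_simps(1))
    then have "h abs_summable_on S \<times> S"
      by (rule abs_summable_on_comparison_test) (auto simp: h_def norm_mult)
    then have "h summable_on S \<times> T"
      by (rule summable_on_subset_banach[OF abs_summable_summable]) (use T(2) in blast)
    then have "(\<Sum>\<^sub>\<infinity>u\<in>S. \<Sum>\<^sub>\<infinity>t\<in>T. h (u, t)) = infsum h (S \<times> T)"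
      by (rule infsum_Sigma_banach)
    moreover have "(\<Sum>\<^sub>\<infinity>t\<in>T. h (u, t)) = a u * of_bool (u = y)" if "u \<in> S" for u
      unfolding h_def
      by (simp only: infsum_finite[OF T(1)] prod.case sum_distrib_left[symmetric] unit[OF that True])
    ultimately have "(\<Sum>\<^sub>\<infinity>u\<in>S. a u * of_bool (u = y)) = infsum h (S \<times> T)"
      by (simp cong: infsum_cong)
    also have "\<dots> = amult A a e y"
      unfolding l1_algebra_simps(5) h_def
      using T support by (intro infsum_cong_neutral) auto
    finally have "amult A a e y = (\<Sum>\<^sub>\<infinity>u\<in>S. a u * of_bool (u = y))" ..
    also have "\<dots> = (\<Sum>\<^sub>\<infinity>u\<in>{y}. a u)"
      using True by (intro infsum_cong_neutral) auto
    finally show ?thesis by simp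
  qed
qed

end

section \<open>The Brandt semigroup\<close>

lemma brandt_closed_operation:
  assumes "group G"
  shows "closed_operation (brandt_carrier G I) (brandt_mult G)"
  by unfold_locales (rule brandt_mult_closed[OF assms])

text \<open>
  The diagonal entry at \<open>j\<close> is linked to the one at \<open>i\<close> by the off-diagonal entry at \<open>(i, j)\<close>,
  which serves as both \<open>s\<close> and \<open>y\<close> in \<open>finite_if_linked\<close>.
\<close>

lemma finite_index_set:
  fixes G :: "('g, 'b) monoid_scheme" and I :: "'i set"
  assumes "group G" and "I \<noteq> {}"
    and uca: "has_ultra_central_approx_identity (l1_algebra (brandt_carrier G I) (brandt_mult G))"
  shows "finite I"
proof -
  interpret G: group G by fact
  interpret S: closed_operation "brandt_carrier G I" "brandt_mult G"
    by (rule brandt_closed_operation[OF \<open>group G\<close>])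
  let ?E = "Entry \<one>\<^bsub>G\<^esub>"
  obtain i where i: "i \<in> I" using \<open>I \<noteq> {}\<close> by blast
  have left: "brandt_mult G (?E j k) u = ?E j k \<longleftrightarrow> u = ?E k k"
    and right: "brandt_mult G u (?E j k) = ?E j k \<longleftrightarrow> u = ?E j j"
    if "u \<in> brandt_carrier G I" for u j k
    using that by (cases u; auto simp: brandt_carrier_def)+
  have "finite ((\<lambda>j. ?E j j) ` I)"
  proof (rule S.finite_if_linked[OF uca])
    show "?E i i \<in> brandt_carrier G I" using i by (simp add: brandt_carrier_def)
    show "(\<lambda>j. ?E j j) ` I \<subseteq> brandt_carrier G I" by (auto simp: brandt_carrier_def)
    fix t assume "t \<in> (\<lambda>j. ?E j j) ` I"
    then obtain j where j: "j \<in> I" "t = ?E j j" by blast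
    have "?E i j \<in> brandt_carrier G I" using i j by (simp add: brandt_carrier_def)
    then show "\<exists>s\<in>brandt_carrier G I. \<exists>y. \<forall>u\<in>brandt_carrier G I.
        (brandt_mult G s u = y \<longleftrightarrow> u = t) \<and> (brandt_mult G u s = y \<longleftrightarrow> u = ?E i i)"
      using left right j(2) by blast
  qed (rule right)
  then show "finite I" by (rule finite_imageD) (auto intro: inj_onI)
qed

text \<open>
  The sum of the diagonal point masses is not itself an identity, because mismatched products
  are the point mass at \<open>Zero\<close> and not the zero of \<open>\<ell>\<^sup>1(S)\<close>. Each matrix entry meets
  \<open>card I - 1\<close> mismatched diagonal entries, which the value at \<open>Zero\<close> cancels; at the point
  mass of \<open>Zero\<close> itself, \<open>card I\<close> products plus this value leave \<open>1\<close>.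
\<close>

definition brandt_identity ::
  "('g, 'b) monoid_scheme \<Rightarrow> 'i set \<Rightarrow> ('g, 'i) brandt \<Rightarrow> complex" where
  "brandt_identity G I s =
     (if s = Zero then 1 - of_nat (card I) else of_bool (s \<in> (\<lambda>i. Entry \<one>\<^bsub>G\<^esub> i i) ` I))"

lemma brandt_identity_sum:
  assumes "finite I"
  shows "(\<Sum>t\<in>insert Zero ((\<lambda>i. Entry \<one>\<^bsub>G\<^esub> i i) ` I). of_bool (P t) * brandt_identity G I t) =
     of_bool (P Zero) * (1 - of_nat (card I)) + (\<Sum>i\<in>I. of_bool (P (Entry \<one>\<^bsub>G\<^esub> i i)))"
proof -
  have "(\<Sum>t\<in>(\<lambda>i. Entry \<one>\<^bsub>G\<^esub> i i) ` I. of_bool (P t) * brandt_identity G I t) =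
      (\<Sum>i\<in>I. of_bool (P (Entry \<one>\<^bsub>G\<^esub> i i)))"
    by (subst sum.reindex) (auto simp: inj_on_def brandt_identity_def intro!: sum.cong)
  then show ?thesis
    using assms by (subst sum.insert) (auto simp: brandt_identity_def[of _ _ Zero])
qed

lemma brandt_identity_point_mass:
  assumes "group G" "finite I" and u: "u \<in> brandt_carrier G I"
  defines "T \<equiv> insert Zero ((\<lambda>i. Entry \<one>\<^bsub>G\<^esub> i i) ` I)"
  shows "(\<Sum>t\<in>T. of_bool (brandt_mult G u t = y) * brandt_identity G I t) = of_bool (u = y)"
    and "(\<Sum>t\<in>T. of_bool (brandt_mult G t u = y) * brandt_identity G I t) = of_bool (u = y)"
proof -
  interpret G: group G by fact
  \<comment> \<open>\<open>P\<close> is for the one diagonal entry that matches \<open>u\<close>, \<open>Q\<close> for the others.\<close>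
  have count: "(\<Sum>k\<in>I. of_bool (if k = i then P else Q) :: complex) =
      of_bool P + of_bool Q * (of_nat (card I) - 1)" if "i \<in> I" for i P Q
  proof -
    have "(\<Sum>k\<in>I. of_bool (if k = i then P else Q) :: complex) = of_bool P + (\<Sum>k\<in>I - {i}. of_bool Q)"
      using \<open>finite I\<close> that by (subst sum.remove[of _ i]) auto
    moreover have "1 \<le> card I" using \<open>finite I\<close> that by (simp add: Suc_le_eq card_gt_0_iff) blast
    ultimately show ?thesis using \<open>finite I\<close> that by (simp add: card_Diff_singleton of_nat_diff)
  qed
  show "(\<Sum>t\<in>T. of_bool (brandt_mult G u t = y) * brandt_identity G I t) = of_bool (u = y)"
  proof (cases u)
    case Zero
    then show ?thesis unfolding T_def by (subst brandt_identity_sum) (auto simp: \<open>finite I\<close>)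
  next
    case (Entry g i j)
    then have "g \<in> carrier G" "i \<in> I" "j \<in> I" using u by (auto simp: brandt_carrier_def)
    moreover have "(brandt_mult G u (Entry \<one>\<^bsub>G\<^esub> k k) = y) = (if k = j then u = y else Zero = y)" for k
      using Entry \<open>g \<in> carrier G\<close> by auto
    ultimately show ?thesis
      using Entry \<open>finite I\<close> count[of j "u = y" "Zero = y"] unfolding T_def
      by (subst brandt_identity_sum) auto
  qed
  show "(\<Sum>t\<in>T. of_bool (brandt_mult G t u = y) * brandt_identity G I t) = of_bool (u = y)"
  proof (cases u)
    case Zero
    then show ?thesis unfolding T_def by (subst brandt_identity_sum) (auto simp: \<open>finite I\<close>)
  next
    case (Entry g i j)
    then have "g \<in> carrier G" "i \<in> I" "j \<in> I" using u by (auto simp: brandt_carrier_def)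
    moreover have "(brandt_mult G (Entry \<one>\<^bsub>G\<^esub> k k) u = y) = (if k = i then u = y else Zero = y)" for k
      using Entry \<open>g \<in> carrier G\<close> by auto
    ultimately show ?thesis
      using Entry \<open>finite I\<close> count[of i "u = y" "Zero = y"] unfolding T_def
      by (subst brandt_identity_sum) auto
  qed
qed

text \<open>
  The left identity property is the right one for the opposite multiplication.
\<close>

lemma has_ultra_central_approx_identity_brandt:
  fixes G :: "('g, 'b) monoid_scheme" and I :: "'i set"
  assumes "group G" and "finite I"
  shows "has_ultra_central_approx_identity (l1_algebra (brandt_carrier G I) (brandt_mult G))"
proof -
  interpret G: group G by fact
  interpret S: closed_operation "brandt_carrier G I" "brandt_mult G"
    by (rule brandt_closed_operation[OF \<open>group G\<close>])
  interpret opposite: closed_operation "brandt_carrier G I" "\<lambda>s t. brandt_mult G t s"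
    by (rule S.opposite_closed)
  define T where "T = insert Zero ((\<lambda>i. Entry \<one>\<^bsub>G\<^esub> i i) ` I)"
  let ?e = "brandt_identity G I"
  have T: "finite T" "T \<subseteq> brandt_carrier G I"
    using \<open>finite I\<close> by (auto simp: T_def brandt_carrier_def)
  have off: "?e s = 0" if "s \<notin> T" for s
    using that by (auto simp: T_def brandt_identity_def)
  have "(\<lambda>s. cmod (?e s)) summable_on brandt_carrier G I \<longleftrightarrow> (\<lambda>s. cmod (?e s)) summable_on T"
    using T off by (intro summable_on_cong_neutral) auto
  then have e: "?e \<in> carrier S.A"
    using T off by (auto simp: l1_algebra_simps)
  show ?thesis
  proof (rule S.has_ultra_central_approx_identity_if_identity[OF e])
    fix a assume a: "a \<in> carrier S.A"
    show "amult S.A a ?e = a"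
      using brandt_identity_point_mass(1)[OF assms] unfolding T_def[symmetric]
      by (intro S.amult_l1_right_identity[OF T e off _ a])
    have "amult opposite.A a ?e = a"
      using brandt_identity_point_mass(2)[OF assms] e a unfolding T_def[symmetric]
      by (intro opposite.amult_l1_right_identity[OF T _ off]) (simp_all add: l1_algebra_simps(1))
    then show "amult S.A ?e a = a" by (simp add: amult_l1_swap[of _ "brandt_mult G"])
  qed
qed

theorem theorem2p7:
  fixes G :: "('g, 'b) monoid_scheme" and I :: "'i set"
  assumes "group G" and "I \<noteq> {}"
  shows "has_ultra_central_approx_identity
           (l1_algebra (brandt_carrier G I) (brandt_mult G)) \<longleftrightarrow> finite I"
  using finite_index_set[OF assms] has_ultra_central_approx_identity_brandt[OF assms(1)] by blast

end
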